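(* Let $\mathcal{A}$ be an adequate family of subsets of $\mathbb{N}$, let $X = h_{\mathcal{A},1}$ and let $x^*\in B_{X^*}$. Then the following are equivalent: (i) $x^*$ is an extreme point of $B_{X^*}$; (ii) $x^*$ is a $w^*$-exposed point of $B_{X^*}$. In particular, if $\mathcal{A}$ is an adequate family of finite sets, then $x^*$ is an extreme point of $B_{X^*}$ if and only if $x^*$ is a $w^*$-strongly exposed point of $B_{X^*}$.
   Context: All Banach spaces are real. $B_X$, $S_X$, $X^*$ denote the closed unit ball, unit sphere and topological dual of a Banach space $X$. Adequate family: a family $\mathcal{A}$ of subsets of $\mathbb{N}=\{1,2,\dots\}$ is adequate if (1) it contains the empty set and all singletons $\{i\}$, $i\in\mathbb{N}$; (2) it is hereditary: $A\in\mathcal{A}$ and $B\subseteq A$ imply $B\in\mathcal{A}$; (3) it is compact for pointwise convergence, i.e. given $A\subset\mathbb{N}$, if every finite subset of $A$ is in $\mathcal{A}$, then $A\in\mathcal{A}$. An adequate family of finite sets is one all of whose members are finite. The space $h_{\mathcal{A},1}$: the completion of the space $c_{00}$ of finitely supported sequences, with standard basis $(e_i)_{i\in\mathbb{N}}$, in the norm $\left\|\sum_{i=1}^n a_i e_i\right\| = \sup_{A\in\mathcal{A}}\sum_{i\in A}|a_i|$ (with $a_i=0$ for $i>n$). $f\in B_{X^*}$ is a $w^*$-exposed point of $B_{X^*}$ if there is $x\in S_X$ with $f(x)=1$ and $g(x)<1$ for all $g\in B_{X^*}\setminus\{f\}$. It is a $w^*$-strongly exposed point if there is $x\in S_X$ with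 $f(x)=1$ such that $\|f_n-f\|\to 0$ whenever $(f_n)\subset B_{X^*}$ and $f_n(x)\to 1$. *)

theory Defs
  imports "HOL-Analysis.Analysis"
begin

definition adequate_family :: "nat set set \<Rightarrow> bool" where
  "adequate_family \<A> \<longleftrightarrow>
     (\<forall>A\<in>\<A>. A \<subseteq> {1..}) \<and>
     {} \<in> \<A> \<and> (\<forall>i\<ge>1. {i} \<in> \<A>) \<and>
     (\<forall>A\<in>\<A>. \<forall>B. B \<subseteq> A \<longrightarrow> B \<in> \<A>) \<and>
     (\<forall>A. A \<subseteq> {1..} \<longrightarrow> (\<forall>F. F \<subseteq> A \<longrightarrow> finite F \<longrightarrow> F \<in> \<A>) \<longrightarrow> A \<in> \<A>)"

text \<open>
  A type cannot depend on \<open>\<A>\<close>, so the completion of \<open>c\<^sub>0\<^sub>0\<close> is not constructed but described: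
  a Banach space (the whole type \<open>'a\<close>) together with vectors \<open>e 1, e 2, \<dots>\<close> on whose finite
  linear combinations the norm is the one induced by \<open>\<A>\<close>, and whose linear span is dense.
  Since \<open>\<A>\<close> contains the singletons, the norm formula makes \<open>e 1, e 2, \<dots>\<close> linearly independent,
  so their span is an isometric copy of the normed space \<open>c\<^sub>0\<^sub>0\<close>, and \<open>'a\<close> is its completion,
  unique up to isometric isomorphism.  The value \<open>e 0\<close> is irrelevant.

  The supremum is over a nonempty set of reals bounded by \<open>\<Sum>i=1..n. \<bar>a i\<bar>\<close>; intersecting with
  \<open>{1..n}\<close> expresses that \<open>a i = 0\<close> for \<open>i > n\<close>.
\<close>

definition is_h_space :: "nat set set \<Rightarrow> (nat \<Rightarrow> 'a::banach) \<Rightarrow> bool" where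
  "is_h_space \<A> e \<longleftrightarrow>
     (\<forall>(n::nat) (a :: nat \<Rightarrow> real).
        norm (\<Sum>i=1..n. a i *\<^sub>R e i) = (SUP A\<in>\<A>. \<Sum>i\<in>A \<inter> {1..n}. \<bar>a i\<bar>)) \<and>
     closure (span (e ` {1..})) = UNIV"

definition weak_star_exposed :: "('a::real_normed_vector \<Rightarrow>\<^sub>L real) \<Rightarrow> bool" where
  "weak_star_exposed f \<longleftrightarrow>
     f \<in> cball 0 1 \<and>
     (\<exists>x\<in>sphere 0 1. blinfun_apply f x = 1 \<and>
        (\<forall>g\<in>cball 0 1 - {f}. blinfun_apply g x < 1))"

definition weak_star_strongly_exposed :: "('a::real_normed_vector \<Rightarrow>\<^sub>L real) \<Rightarrow> bool" where
  "weak_star_strongly_exposed f \<longleftrightarrow>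
     f \<in> cball 0 1 \<and>
     (\<exists>x\<in>sphere 0 1. blinfun_apply f x = 1 \<and>
        (\<forall>F :: nat \<Rightarrow> 'a \<Rightarrow>\<^sub>L real.
           range F \<subseteq> cball 0 1 \<longrightarrow> (\<lambda>n. blinfun_apply (F n) x) \<longlonglongrightarrow> 1 \<longrightarrow>
           (\<lambda>n. norm (F n - f)) \<longlonglongrightarrow> 0))"

end

theory Submission imports Defs "HOL-Complex_Analysis.Great_Picard" begin

text \<open>
  The extreme points of the dual ball are the functionals that are \<open>\<plusminus>1\<close> on a maximal member of
  \<open>\<A>\<close> and \<open>0\<close> elsewhere.  For such a functional \<open>f\<close> with support \<open>S\<close>, any \<open>g\<close> in the ball that
  agrees with \<open>f\<close> on \<open>S\<close> equals \<open>f\<close> by maximality, so the normalised series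
  \<open>\<Sum>i\<in>S. 2\<^sup>-\<^sup>i f(e i) e i\<close> exposes \<open>f\<close>; if \<open>S\<close> is finite, the average \<open>x\<close> of
  the \<open>f(e i) e i\<close> satisfies \<open>\<parallel>g - f\<parallel> \<le> 2 |S| (1 - g x)\<close>.

  That an extreme point has coefficients in \<open>{-1, 0, 1}\<close> is an elementary form of Milman's theorem.
  On the first \<open>n\<close> coordinates a functional of norm at most \<open>1\<close> is a convex combination of sign
  functionals, which are grouped by whether their \<open>i\<close>-th coefficient is \<open>1\<close> or at most \<open>0\<close>.
  A diagonal argument in \<open>n\<close> splits \<open>f\<close> as \<open>p + (f - p)\<close> with \<open>\<parallel>p\<parallel> \<le> t\<close>,
  \<open>\<parallel>f - p\<parallel> \<le> 1 - t\<close> and \<open>p(e i) = t\<close>, so extremality forces \<open>f(e i) = 1\<close> or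
  \<open>f(e i) \<le> 0\<close>; the same holds for \<open>-f\<close>.
\<close>

section \<open>The norm on finite combinations and independence of the basis\<close>

locale h_space =
  fixes \<A> :: "nat set set" and e :: "nat \<Rightarrow> 'a::banach"
  assumes adequate: "adequate_family \<A>" and is_h_space: "is_h_space \<A> e"
begin

lemma positive_members: "A \<in> \<A> \<Longrightarrow> i \<in> A \<Longrightarrow> i \<ge> 1"
  using adequate unfolding adequate_family_def by fastforce

lemma hereditary: "A \<in> \<A> \<Longrightarrow> B \<subseteq> A \<Longrightarrow> B \<in> \<A>"
  using adequate unfolding adequate_family_def by blast

lemma empty_member: "{} \<in> \<A>"
  using adequate unfolding adequate_family_def by blast

lemma singleton_member: "i \<ge> 1 \<Longrightarrow> {i} \<in> \<A>"
  using adequate unfolding adequate_family_def by blast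

lemma memberI:
  "A \<subseteq> {1..} \<Longrightarrow> (\<And>F. F \<subseteq> A \<Longrightarrow> finite F \<Longrightarrow> F \<in> \<A>) \<Longrightarrow> A \<in> \<A>"
  using adequate unfolding adequate_family_def by blast

lemma norm_combination:
  "norm (\<Sum>i=1..n. a i *\<^sub>R e i) = (SUP A\<in>\<A>. \<Sum>i\<in>A \<inter> {1..n}. \<bar>a i\<bar>)"
  using is_h_space unfolding is_h_space_def by blast

lemma dense_span: "closure (span (e ` {1..})) = UNIV"
  using is_h_space unfolding is_h_space_def by blast

lemma sum_abs_le_norm:
  assumes "A \<in> \<A>"
  shows "(\<Sum>i\<in>A \<inter> {1..n}. \<bar>a i\<bar>) \<le> norm (\<Sum>i=1..n. a i *\<^sub>R e i)"
  unfolding norm_combination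
proof (rule cSUP_upper[OF assms])
  show "bdd_above ((\<lambda>A. \<Sum>i\<in>A \<inter> {1..n}. \<bar>a i\<bar>) ` \<A>)"
    by (rule bdd_aboveI2[where M="\<Sum>i=1..n. \<bar>a i\<bar>"]) (auto intro: sum_mono2)
qed

lemma norm_combination_le:
  assumes "\<And>A. A \<in> \<A> \<Longrightarrow> (\<Sum>i\<in>A \<inter> {1..n}. \<bar>a i\<bar>) \<le> M"
  shows "norm (\<Sum>i=1..n. a i *\<^sub>R e i) \<le> M"
  unfolding norm_combination using empty_member assms by (intro cSUP_least) auto

text \<open>Singletons belong to \<open>\<A>\<close>, so each single coefficient competes in the
  supremum. Injectivity and linear independence of the basis rest on this.\<close>

lemma abs_coeff_le_norm:
  assumes "j \<in> {1..n}"
  shows "\<bar>a j\<bar> \<le> norm (\<Sum>i=1..n. a i *\<^sub>R e i)"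
  using sum_abs_le_norm[OF singleton_member, where n=n and a=a] assms by force

text \<open>Padding with zeros brings a sum over any finite index set into the form
  \<open>{1..n}\<close> for which the norm formula is stated.\<close>

lemma interval_sum_eq:
  fixes v :: "nat \<Rightarrow> 'b::real_vector"
  assumes "finite I" "I \<subseteq> {1..}"
  shows "(\<Sum>i\<in>I. u i *\<^sub>R v i) = (\<Sum>i=1..Max I. (if i \<in> I then u i else 0) *\<^sub>R v i)"
proof -
  have "I \<subseteq> {1..Max I}" using assms by auto
  then show ?thesis by (intro sum.mono_neutral_cong_left) auto
qed

lemma span_obtain:
  assumes "v \<in> span (e ` {1..})"
  obtains n a where "v = (\<Sum>i=1..n. a i *\<^sub>R e i)"
proof -
  obtain t r where t: "finite t" "t \<subseteq> e ` {1..}" and v: "v = (\<Sum>x\<in>t. r x *\<^sub>R x)"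
    using assms unfolding span_explicit by blast
  obtain I where I: "I \<subseteq> {1..}" "inj_on e I" "t = e ` I"
    using t(2) unfolding subset_image_inj by blast
  have fin: "finite I" using t(1) I by (simp add: finite_image_iff)
  have "v = (\<Sum>i\<in>I. r (e i) *\<^sub>R e i)"
    unfolding v I(3) by (simp add: sum.reindex[OF I(2)])
  then show ?thesis unfolding interval_sum_eq[OF fin I(1)] by (rule that)
qed

lemma inj_e: "inj_on e {1..}"
proof (rule inj_onI, rule ccontr)
  fix i j assume ij: "i \<in> {1..}" "j \<in> {1..}" "e i = e j" "i \<noteq> j"
  \<comment> \<open>Coefficients of \<open>e i - e j\<close>; the bound \<open>i+j\<close> is merely
    large enough for the interval to contain both indices.\<close>
  let ?a = "\<lambda>k. if k = i then 1 else if k = j then -1 else 0 :: real"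
  have "(\<Sum>k=1..i+j. ?a k *\<^sub>R e k) = (\<Sum>k\<in>{i,j}. ?a k *\<^sub>R e k)"
    using ij by (intro sum.mono_neutral_right) auto
  also have "\<dots> = 0" using ij by simp
  finally show False using abs_coeff_le_norm[of i "i+j" ?a] ij by simp
qed

lemma independent_e: "independent (e ` {1..})"
proof
  assume "dependent (e ` {1..})"
  then obtain t u where t: "finite t" "t \<subseteq> e ` {1..}" "\<exists>v\<in>t. u v \<noteq> 0" "(\<Sum>v\<in>t. u v *\<^sub>R v) = 0"
    unfolding dependent_explicit by blast
  obtain I where I: "I \<subseteq> {1..}" "inj_on e I" "t = e ` I"
    using t(2) unfolding subset_image_inj by blast
  have fin: "finite I" using t(1) I by (simp add: finite_image_iff)
  obtain j where j: "j \<in> I" "u (e j) \<noteq> 0" using t(3) I(3) by auto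
  let ?a = "\<lambda>i. if i \<in> I then u (e i) else 0"
  have "(\<Sum>i\<in>I. u (e i) *\<^sub>R e i) = 0"
    using t(4) unfolding I(3) by (simp add: sum.reindex[OF I(2)])
  then have "norm (\<Sum>i=1..Max I. ?a i *\<^sub>R e i) = 0"
    unfolding interval_sum_eq[OF fin I(1)] by simp
  moreover have "j \<in> {1..Max I}" using j fin I(1) by auto
  ultimately have "\<bar>?a j\<bar> \<le> 0"
    using abs_coeff_le_norm[of j "Max I" ?a] by linarith
  then show False using j by simp
qed

section \<open>Functionals and their coefficients\<close>

lemma blinfun_combination:
  "blinfun_apply g (\<Sum>i=1..n. a i *\<^sub>R e i) = (\<Sum>i=1..n. a i * blinfun_apply g (e i))"
  for g :: "'a \<Rightarrow>\<^sub>L real"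
  by (simp add: blinfun.sum_right blinfun.scaleR_right)

text \<open>The vectors on which the bound holds form a closed set, so density of the span reduces
  the operator norm to finite combinations.\<close>

lemma norm_functional_le:
  fixes g :: "'a \<Rightarrow>\<^sub>L real"
  assumes "\<And>n a. \<bar>\<Sum>i=1..n. a i * blinfun_apply g (e i)\<bar> \<le> C * norm (\<Sum>i=1..n. a i *\<^sub>R e i)"
    and "C \<ge> 0"
  shows "norm g \<le> C"
proof (rule norm_blinfun_bound[OF assms(2)])
  fix x
  have "closed {x. norm (blinfun_apply g x) \<le> C * norm x}"
    by (intro closed_Collect_le continuous_intros)
  moreover have "span (e ` {1..}) \<subseteq> {x. norm (blinfun_apply g x) \<le> C * norm x}"
  proof
    fix v assume "v \<in> span (e ` {1..})"
    then obtain n a where v: "v = (\<Sum>i=1..n. a i *\<^sub>R e i)" by (rule span_obtain)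
    show "v \<in> {x. norm (blinfun_apply g x) \<le> C * norm x}"
      using assms(1)[where n=n and a=a] unfolding v
      by (simp only: blinfun_combination real_norm_def mem_Collect_eq)
  qed
  ultimately show "norm (blinfun_apply g x) \<le> C * norm x"
    using closure_minimal dense_span by blast
qed

lemma functional_eqI:
  fixes g h :: "'a \<Rightarrow>\<^sub>L real"
  assumes "\<And>i. i \<ge> 1 \<Longrightarrow> blinfun_apply g (e i) = blinfun_apply h (e i)"
  shows "g = h"
proof -
  have "norm (g - h) \<le> 0"
    using assms by (intro norm_functional_le) (simp_all add: blinfun.diff_left)
  then show ?thesis by simp
qed

lemma functional_combination_le:
  fixes g :: "'a \<Rightarrow>\<^sub>L real"
  assumes "norm g \<le> C"
  shows "\<bar>\<Sum>i=1..n. a i * blinfun_apply g (e i)\<bar> \<le> C * norm (\<Sum>i=1..n. a i *\<^sub>R e i)"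
proof -
  have "norm (blinfun_apply g (\<Sum>i=1..n. a i *\<^sub>R e i)) \<le> norm g * norm (\<Sum>i=1..n. a i *\<^sub>R e i)"
    by (rule norm_blinfun)
  also have "\<dots> \<le> C * norm (\<Sum>i=1..n. a i *\<^sub>R e i)"
    using assms by (simp add: mult_right_mono)
  finally show ?thesis by (simp only: blinfun_combination real_norm_def)
qed

text \<open>Independence allows arbitrary values on the basis; the bound makes the resulting map
  Lipschitz on the span, hence uniformly continuous and extendable to the closure, which is the
  whole space.\<close>

lemma exists_functional:
  assumes "\<And>n a. \<bar>\<Sum>i=1..n. a i * c i\<bar> \<le> C * norm (\<Sum>i=1..n. a i *\<^sub>R e i)" and "C \<ge> 0"
  obtains g :: "'a \<Rightarrow>\<^sub>L real" where "norm g \<le> C" "\<And>i. i \<ge> 1 \<Longrightarrow> blinfun_apply g (e i) = c i"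
proof -
  let ?S = "span (e ` {1..})"
  \<comment> \<open>\<open>\<phi>\<close> is linear everywhere but controlled only on the span; the
    continuous extension \<open>h\<close> of its restriction is what becomes the functional.\<close>
  obtain \<phi> where lin: "linear \<phi>" and \<phi>: "\<forall>x\<in>e ` {1..}. \<phi> x = c (the_inv_into {1..} e x)"
    using linear_independent_extend[OF independent_e, of "\<lambda>x. c (the_inv_into {1..} e x)"]
    by (elim exE conjE)
  have \<phi>e: "\<phi> (e i) = c i" if "i \<ge> 1" for i
    using \<phi> that inj_e by (simp add: the_inv_into_f_f)
  have bound: "\<bar>\<phi> v\<bar> \<le> C * norm v" if v: "v \<in> ?S" for v
  proof -
    obtain n a where v: "v = (\<Sum>i=1..n. a i *\<^sub>R e i)" using v by (rule span_obtain)
    have "\<phi> v = (\<Sum>i=1..n. a i * c i)"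
      unfolding v by (simp add: linear_sum[OF lin] linear_scale[OF lin] \<phi>e)
    then show ?thesis using assms(1)[where n=n and a=a] v by simp
  qed
  have "C-lipschitz_on ?S \<phi>"
  proof (rule lipschitz_onI[OF _ assms(2)])
    fix x y assume "x \<in> ?S" "y \<in> ?S"
    then show "dist (\<phi> x) (\<phi> y) \<le> C * dist x y"
      using bound[OF span_diff] by (simp add: dist_norm linear_diff[OF lin])
  qed
  then have "uniformly_continuous_on ?S \<phi>"
    by (rule lipschitz_on_uniformly_continuous)
  then obtain h where h: "uniformly_continuous_on (closure ?S) h" "\<And>x. x \<in> ?S \<Longrightarrow> \<phi> x = h x"
    by (rule uniformly_continuous_on_extension_on_closure) blast
  have "continuous_on UNIV h"
    using h(1) dense_span uniformly_continuous_imp_continuous by auto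
  then have lim: "(\<lambda>n. h (s n)) \<longlonglongrightarrow> h x" if "s \<longlonglongrightarrow> x" for s x
    using continuous_on_tendsto_compose[OF \<open>continuous_on UNIV h\<close> that] by simp
  have approx: "\<exists>s. (\<forall>n. s n \<in> ?S) \<and> s \<longlonglongrightarrow> x" for x
    using dense_span closure_sequential[of x ?S] by auto
  \<comment> \<open>Additivity, homogeneity and the bound hold for \<open>\<phi>\<close> on the span
    and pass to limits of sequences in it.\<close>
  have "bounded_linear h"
  proof (rule bounded_linear_intro)
    fix x y
    obtain s t where s: "\<And>n. s n \<in> ?S" "s \<longlonglongrightarrow> x" and t: "\<And>n. t n \<in> ?S" "t \<longlonglongrightarrow> y"
      using approx by metis
    have "h (s n + t n) = h (s n) + h (t n)" for n
      using s(1) t(1) h(2) by (metis span_add linear_add[OF lin])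
    then have "(\<lambda>n. h (s n + t n)) \<longlonglongrightarrow> h x + h y"
      using lim[OF s(2)] lim[OF t(2)] by (simp add: tendsto_add)
    then show "h (x + y) = h x + h y"
      using lim[OF tendsto_add[OF s(2) t(2)]] LIMSEQ_unique by blast
  next
    fix r x
    obtain s where s: "\<And>n. s n \<in> ?S" "s \<longlonglongrightarrow> x"
      using approx by metis
    have "h (r *\<^sub>R s n) = r *\<^sub>R h (s n)" for n
      using s(1) h(2) by (metis span_scale linear_scale[OF lin])
    then have "(\<lambda>n. h (r *\<^sub>R s n)) \<longlonglongrightarrow> r *\<^sub>R h x"
      using tendsto_scaleR[OF tendsto_const lim[OF s(2)]] by simp
    then show "h (r *\<^sub>R x) = r *\<^sub>R h x"
      using lim[OF tendsto_scaleR[OF tendsto_const s(2)]] LIMSEQ_unique by blast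
  next
    fix x
    obtain s where s: "\<And>n. s n \<in> ?S" "s \<longlonglongrightarrow> x"
      using approx by metis
    have "norm (h (s n)) \<le> norm (s n) * C" for n
      using s(1) h(2) bound by (simp add: mult.commute)
    then show "norm (h x) \<le> norm x * C"
      using LIMSEQ_le[OF tendsto_norm[OF lim[OF s(2)]] tendsto_mult[OF tendsto_norm[OF s(2)] tendsto_const]]
      by blast
  qed
  then have g: "blinfun_apply (Blinfun h) = h" by (simp add: bounded_linear_Blinfun_apply)
  have ge: "blinfun_apply (Blinfun h) (e i) = c i" if "i \<ge> 1" for i
    using that g h(2) \<phi>e by (metis atLeast_iff imageI span_base)
  moreover have "norm (Blinfun h) \<le> C"
    using assms ge by (intro norm_functional_le) auto
  ultimately show ?thesis using that by blast
qed


section \<open>Sign functionals supported on members\<close>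

text \<open>The left side is at most the sum of \<open>\<bar>a i\<bar>\<close> over the one member
  \<open>A\<close>, which is a term of the supremum. Together with \<open>exists_functional\<close>
  this produces functionals in the dual ball.\<close>

lemma member_combination_le:
  assumes "A \<in> \<A>" and "\<And>i. i \<ge> 1 \<Longrightarrow> \<bar>c i\<bar> \<le> 1" and "\<And>i. i \<ge> 1 \<Longrightarrow> i \<notin> A \<Longrightarrow> c i = 0"
  shows "\<bar>\<Sum>i=1..n. a i * c i\<bar> \<le> norm (\<Sum>i=1..n. a i *\<^sub>R e i)"
proof -
  have "(\<Sum>i=1..n. a i * c i) = (\<Sum>i\<in>A \<inter> {1..n}. a i * c i)"
    using assms(3) by (intro sum.mono_neutral_right) (auto, force)
  also have "\<bar>\<dots>\<bar> \<le> (\<Sum>i\<in>A \<inter> {1..n}. \<bar>a i\<bar>)"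
    using assms(2) by (intro order_trans[OF sum_abs] sum_mono) (auto simp: abs_mult intro: mult_left_le)
  finally show ?thesis using sum_abs_le_norm[OF assms(1), where n=n and a=a] by linarith
qed

text \<open>Candidates for the extreme points seen on the first \<open>n\<close> coordinates.
  Cutting the support off at \<open>n\<close> makes the set finite, so that its convex hull is
  compact.\<close>

definition sign_functionals :: "nat \<Rightarrow> ('a \<Rightarrow>\<^sub>L real) set" where
  "sign_functionals n = {g. (\<forall>i\<ge>1. blinfun_apply g (e i) \<in> {-1, 0, 1}) \<and>
     (\<forall>i>n. blinfun_apply g (e i) = 0) \<and> {i. i \<ge> 1 \<and> blinfun_apply g (e i) \<noteq> 0} \<in> \<A>}"

lemma norm_sign_functional:
  assumes "g \<in> sign_functionals n"
  shows "norm g \<le> 1"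
proof (rule norm_functional_le)
  fix m a
  have "\<bar>blinfun_apply g (e i)\<bar> \<le> 1" if "i \<ge> 1" for i
    using assms that unfolding sign_functionals_def by fastforce
  then show "\<bar>\<Sum>i=1..m. a i * blinfun_apply g (e i)\<bar> \<le> 1 * norm (\<Sum>i=1..m. a i *\<^sub>R e i)"
    using member_combination_le[of "{i. i \<ge> 1 \<and> blinfun_apply g (e i) \<noteq> 0}"
        "\<lambda>i. blinfun_apply g (e i)" a m] assms
    unfolding sign_functionals_def by auto
qed simp

lemma sign_functional_exists:
  assumes "A \<in> \<A>" "A \<subseteq> {1..n}" "\<And>i. c i \<in> {-1, 0, 1::real}"
  obtains g where "g \<in> sign_functionals n"
    "\<And>i. i \<ge> 1 \<Longrightarrow> blinfun_apply g (e i) = (if i \<in> A then c i else 0)"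
proof -
  let ?c = "\<lambda>i. if i \<in> A then c i else 0"
  have c: "\<bar>?c i\<bar> \<le> 1" for i using assms(3)[of i] by auto
  obtain g :: "'a \<Rightarrow>\<^sub>L real" where g: "\<And>i. i \<ge> 1 \<Longrightarrow> blinfun_apply g (e i) = ?c i"
  proof (rule exists_functional[of ?c 1])
    show "\<bar>\<Sum>i=1..m. a i * ?c i\<bar> \<le> 1 * norm (\<Sum>i=1..m. a i *\<^sub>R e i)" for m a
      using member_combination_le[OF assms(1), of ?c a m] c by simp
  qed auto
  have "{i. i \<ge> 1 \<and> blinfun_apply g (e i) \<noteq> 0} \<subseteq> A"
    using g by (auto split: if_splits)
  then have "{i. i \<ge> 1 \<and> blinfun_apply g (e i) \<noteq> 0} \<in> \<A>"
    using hereditary[OF assms(1)] by blast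
  moreover have "blinfun_apply g (e i) \<in> {-1, 0, 1}" if "i \<ge> 1" for i
    using g[OF that] assms(3)[of i] by simp
  moreover have "blinfun_apply g (e i) = 0" if "i > n" for i
    using g[of i] that assms(2) by auto
  ultimately have "g \<in> sign_functionals n"
    unfolding sign_functionals_def by blast
  then show ?thesis using g that by blast
qed

lemma finite_sign_functionals: "finite (sign_functionals n)"
proof (rule inj_on_finite)
  let ?r = "\<lambda>g :: 'a \<Rightarrow>\<^sub>L real. \<lambda>i\<in>{1..n}. blinfun_apply g (e i)"
  show "inj_on ?r (sign_functionals n)"
  proof (rule inj_onI)
    fix g h assume gh: "g \<in> sign_functionals n" "h \<in> sign_functionals n" "?r g = ?r h"
    show "g = h"
    proof (rule functional_eqI)
      fix i :: nat assume "i \<ge> 1"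
      show "blinfun_apply g (e i) = blinfun_apply h (e i)"
      proof (cases "i \<le> n")
        case True
        then show ?thesis using fun_cong[OF gh(3), of i] \<open>i \<ge> 1\<close> by simp
      next
        case False
        then show ?thesis using gh(1,2) unfolding sign_functionals_def by simp
      qed
    qed
  qed
  show "?r ` sign_functionals n \<subseteq> {1..n} \<rightarrow>\<^sub>E {-1, 0, 1}"
    unfolding sign_functionals_def by (auto simp: PiE_iff)
  show "finite ({1..n} \<rightarrow>\<^sub>E {-1, 0, 1::real})"
    by (intro finite_PiE) auto
qed

section \<open>Matching finitely many coordinates by a hull of sign functionals\<close>

text \<open>The first-order condition at a minimum: after division by \<open>t\<close> the right
  side tends to 0.\<close>

lemma quadratic_slope_nonpos:
  fixes s q :: real
  assumes "\<And>t. 0 < t \<Longrightarrow> t \<le> 1 \<Longrightarrow> 2 * t * s \<le> t^2 * q"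
  shows "s \<le> 0"
proof (rule ccontr)
  assume "\<not> s \<le> 0"
  then have s: "s > 0" by simp
  \<comment> \<open>Chosen so that \<open>t * q\<close> is at most \<open>s\<close>, against the
    inequality \<open>2 * s \<le> t * q\<close> that the assumption yields.\<close>
  define t where "t = min 1 (s / (\<bar>q\<bar> + 1))"
  have t: "0 < t" "t \<le> 1" "t \<le> s / (\<bar>q\<bar> + 1)" using s by (auto simp: t_def)
  have "t * (2 * s) \<le> t * (t * q)" using assms[OF t(1,2)] by (simp add: power2_eq_square)
  then have "2 * s \<le> t * q" using t(1) by simp
  also have "\<dots> \<le> t * (\<bar>q\<bar> + 1)" using t(1) by (intro mult_left_mono) auto
  also have "\<dots> \<le> s" using t(3) by (simp add: field_simps)
  finally show False using s by simp
qed

text \<open>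
  The minimiser of the quadratic distance exists since the hull of finitely many functionals is
  compact; its variational inequality replaces a separation theorem.
\<close>

lemma hull_sign_functionals_match:
  fixes f :: "'a \<Rightarrow>\<^sub>L real"
  assumes "norm f \<le> 1"
  obtains g where "g \<in> convex hull sign_functionals n"
    "\<And>i. i \<in> {1..n} \<Longrightarrow> blinfun_apply g (e i) = blinfun_apply f (e i)"
proof -
  let ?K = "convex hull sign_functionals n"
  let ?q = "\<lambda>g. \<Sum>i=1..n. (blinfun_apply f (e i) - blinfun_apply g (e i))\<^sup>2"
  have "compact ?K" by (intro finite_imp_compact_convex_hull finite_sign_functionals)
  moreover obtain z where "z \<in> sign_functionals n"
    using sign_functional_exists[OF empty_member, of n "\<lambda>_. 0"] by auto
  then have "?K \<noteq> {}" using hull_inc by fastforce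
  moreover have "continuous_on ?K ?q" by (intro continuous_intros)
  ultimately obtain y where y: "y \<in> ?K" "\<And>g. g \<in> ?K \<Longrightarrow> ?q y \<le> ?q g"
    using continuous_attains_inf[of ?K ?q] by blast
  define d where "d i = blinfun_apply f (e i) - blinfun_apply y (e i)" for i
  \<comment> \<open>Moving from \<open>y\<close> towards \<open>g\<close> by \<open>t\<close>
    changes the squared distance by \<open>- 2 * t\<close> times the sum of
    \<open>d i * w i\<close>, plus a term of order \<open>t^2\<close>; minimality of
    \<open>y\<close> rules out a positive slope.\<close>
  have slope: "(\<Sum>i=1..n. d i * blinfun_apply g (e i)) \<le> (\<Sum>i=1..n. d i * blinfun_apply y (e i))"
    if g: "g \<in> sign_functionals n" for g
  proof -
    define w where "w i = blinfun_apply g (e i) - blinfun_apply y (e i)" for i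
    have "(\<Sum>i=1..n. d i * w i) \<le> 0"
    proof (rule quadratic_slope_nonpos)
      fix t :: real assume t: "0 < t" "t \<le> 1"
      let ?p = "(1 - t) *\<^sub>R y + t *\<^sub>R g"
      have "?p \<in> ?K"
        using t y(1) hull_inc[of g "sign_functionals n" convex] g convex_convex_hull
        by (intro convexD_alt) auto
      then have "(\<Sum>i=1..n. (d i)\<^sup>2) \<le> ?q ?p"
        using y(2) unfolding d_def by blast
      also have "\<dots> = (\<Sum>i=1..n. (d i)\<^sup>2 - 2 * t * (d i * w i) + t\<^sup>2 * (w i)\<^sup>2)"
      proof (intro sum.cong refl)
        fix i
        have "blinfun_apply f (e i) - blinfun_apply ?p (e i) = d i - t * w i"
          by (simp add: d_def w_def blinfun.add_left blinfun.scaleR_left left_diff_distrib right_diff_distrib)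
        then show "(blinfun_apply f (e i) - blinfun_apply ?p (e i))\<^sup>2
            = (d i)\<^sup>2 - 2 * t * (d i * w i) + t\<^sup>2 * (w i)\<^sup>2"
          by (simp only:) (simp add: power2_eq_square algebra_simps)
      qed
      also have "\<dots> = (\<Sum>i=1..n. (d i)\<^sup>2) - 2 * t * (\<Sum>i=1..n. d i * w i) + t\<^sup>2 * (\<Sum>i=1..n. (w i)\<^sup>2)"
        by (simp add: sum.distrib sum_subtractf sum_distrib_left)
      finally show "2 * t * (\<Sum>i=1..n. d i * w i) \<le> t\<^sup>2 * (\<Sum>i=1..n. (w i)\<^sup>2)" by simp
    qed
    then show ?thesis by (simp add: w_def right_diff_distrib sum_subtractf)
  qed
  \<comment> \<open>For each member the sign functional carrying the signs of \<open>d\<close> there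
    attains the corresponding sum, so \<open>slope\<close> bounds all terms of the supremum at
    once.\<close>
  have "norm (\<Sum>i=1..n. d i *\<^sub>R e i) \<le> (\<Sum>i=1..n. d i * blinfun_apply y (e i))"
  proof (rule norm_combination_le)
    fix A assume A: "A \<in> \<A>"
    have "A \<inter> {1..n} \<in> \<A>" using hereditary[OF A] by blast
    then obtain g where g: "g \<in> sign_functionals n"
      "\<And>i. i \<ge> 1 \<Longrightarrow> blinfun_apply g (e i) = (if i \<in> A \<inter> {1..n} then sgn (d i) else 0)"
      by (rule sign_functional_exists[of _ n "\<lambda>i. sgn (d i)"]) (auto simp: sgn_if)
    have "(\<Sum>i\<in>A \<inter> {1..n}. \<bar>d i\<bar>) = (\<Sum>i=1..n. d i * blinfun_apply g (e i))"
      by (rule sum.mono_neutral_cong_left) (auto simp: g(2) abs_sgn)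
    then show "(\<Sum>i\<in>A \<inter> {1..n}. \<bar>d i\<bar>) \<le> (\<Sum>i=1..n. d i * blinfun_apply y (e i))"
      using slope[OF g(1)] by simp
  qed
  then have "(\<Sum>i=1..n. d i * blinfun_apply f (e i)) \<le> (\<Sum>i=1..n. d i * blinfun_apply y (e i))"
    using functional_combination_le[OF assms, where n=n and a=d] by linarith
  \<comment> \<open>The value of \<open>f - y\<close> on the vector with coefficients
    \<open>d\<close> is the squared distance itself. It is therefore at most 0, and \<open>y\<close>
    matches \<open>f\<close>.\<close>
  moreover have "(\<Sum>i=1..n. (d i)\<^sup>2)
      = (\<Sum>i=1..n. d i * blinfun_apply f (e i)) - (\<Sum>i=1..n. d i * blinfun_apply y (e i))"
    by (simp add: d_def power2_eq_square right_diff_distrib sum_subtractf)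
  ultimately have "(\<Sum>i=1..n. (d i)\<^sup>2) \<le> 0" by linarith
  then have "(\<Sum>i=1..n. (d i)\<^sup>2) = 0" by (intro antisym sum_nonneg) auto
  then have "d i = 0" if "i \<in> {1..n}" for i
    using that by (simp add: sum_nonneg_eq_0_iff)
  then show ?thesis using that[OF y(1)] by (simp add: d_def)
qed


section \<open>Norm estimates on finite index sets and splitting of functionals\<close>

lemma norm_finite_combination_le:
  assumes "finite I" "I \<subseteq> {1..}" "\<And>A. A \<in> \<A> \<Longrightarrow> (\<Sum>i\<in>A \<inter> I. \<bar>a i\<bar>) \<le> M"
  shows "norm (\<Sum>i\<in>I. a i *\<^sub>R e i) \<le> M"
  unfolding interval_sum_eq[OF assms(1,2)]
proof (rule norm_combination_le)
  fix A assume "A \<in> \<A>"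
  have "I \<subseteq> {1..Max I}" using assms(1,2) by auto
  then have "(\<Sum>i\<in>A \<inter> {1..Max I}. \<bar>if i \<in> I then a i else 0\<bar>) = (\<Sum>i\<in>A \<inter> I. \<bar>a i\<bar>)"
    by (intro sum.mono_neutral_cong_right) auto
  then show "(\<Sum>i\<in>A \<inter> {1..Max I}. \<bar>if i \<in> I then a i else 0\<bar>) \<le> M"
    using assms(3)[OF \<open>A \<in> \<A>\<close>] by simp
qed

lemma norm_e_le: "i \<ge> 1 \<Longrightarrow> norm (e i) \<le> 1"
proof -
  assume i: "i \<ge> 1"
  have "(\<Sum>j\<in>A \<inter> {i}. \<bar>1\<bar>) \<le> (1::real)" for A
    by (cases "i \<in> A") auto
  then show ?thesis
    using norm_finite_combination_le[of "{i}" "\<lambda>_. 1" 1] i by simp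
qed

lemma abs_functional_e_le:
  fixes g :: "'a \<Rightarrow>\<^sub>L real"
  assumes "norm g \<le> C" "i \<ge> 1"
  shows "\<bar>blinfun_apply g (e i)\<bar> \<le> C"
proof -
  have "\<bar>blinfun_apply g (e i)\<bar> \<le> norm g * norm (e i)"
    using norm_blinfun[of g "e i"] by simp
  also have "\<dots> \<le> C * 1"
    using assms norm_e_le[OF assms(2)] by (intro mult_mono) (auto intro: order_trans[OF norm_ge_zero])
  finally show ?thesis by simp
qed

text \<open>By heredity no member contains \<open>F\<close>, so every member misses an index of
  \<open>F\<close> and loses at least 1. This gain is what turns membership in \<open>\<A>\<close>
  into a statement about norms.\<close>

lemma norm_nonmember_combination_le:
  assumes "finite F" "F \<subseteq> {1..}" "F \<notin> \<A>" "\<And>i. i \<in> F \<Longrightarrow> \<bar>a i\<bar> \<le> 1"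
  shows "norm (\<Sum>i\<in>F. a i *\<^sub>R e i) \<le> real (card F) - 1"
proof (rule norm_finite_combination_le[OF assms(1,2)])
  fix A assume "A \<in> \<A>"
  then have "A \<inter> F \<subset> F" using assms(3) hereditary by blast
  then have "card (A \<inter> F) < card F" by (rule psubset_card_mono[OF assms(1)])
  moreover have "(\<Sum>i\<in>A \<inter> F. \<bar>a i\<bar>) \<le> real (card (A \<inter> F))"
    using sum_bounded_above[of "A \<inter> F" "\<lambda>i. \<bar>a i\<bar>" 1] assms(4) by simp
  ultimately show "(\<Sum>i\<in>A \<inter> F. \<bar>a i\<bar>) \<le> real (card F) - 1" by linarith
qed

text \<open>
  Using \<open>p(e i)\<close> itself as the weight keeps the set of splittable functionals visibly convex.
\<close>

lemma hull_sign_functionals_split: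
  assumes "g \<in> convex hull sign_functionals n" "i \<ge> 1"
  obtains p where "norm p \<le> blinfun_apply p (e i)" "norm (g - p) \<le> 1 - blinfun_apply p (e i)"
    "blinfun_apply g (e i) \<le> blinfun_apply p (e i)"
proof -
  let ?D = "{g. \<exists>p. norm p \<le> blinfun_apply p (e i) \<and> norm (g - p) \<le> 1 - blinfun_apply p (e i) \<and>
    blinfun_apply g (e i) \<le> blinfun_apply p (e i)}"
  have "sign_functionals n \<subseteq> ?D"
  proof
    fix g assume g: "g \<in> sign_functionals n"
    then have "blinfun_apply g (e i) \<in> {-1, 0, 1}"
      using assms(2) unfolding sign_functionals_def by blast
    then have "blinfun_apply g (e i) = 1 \<or> blinfun_apply g (e i) \<le> 0" by auto
    then show "g \<in> ?D"
    proof
      assume "blinfun_apply g (e i) = 1"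
      then show "g \<in> ?D" using norm_sign_functional[OF g] by (auto intro!: exI[of _ g])
    next
      assume "blinfun_apply g (e i) \<le> 0"
      then show "g \<in> ?D" using norm_sign_functional[OF g] by (auto intro!: exI[of _ 0])
    qed
  qed
  moreover have "convex ?D"
  proof (rule convexI)
    fix g h and u v :: real
    assume "g \<in> ?D" "h \<in> ?D" and uv: "0 \<le> u" "0 \<le> v" "u + v = 1"
    then obtain p q where
      p: "norm p \<le> blinfun_apply p (e i)" "norm (g - p) \<le> 1 - blinfun_apply p (e i)"
        "blinfun_apply g (e i) \<le> blinfun_apply p (e i)" and
      q: "norm q \<le> blinfun_apply q (e i)" "norm (h - q) \<le> 1 - blinfun_apply q (e i)"
        "blinfun_apply h (e i) \<le> blinfun_apply q (e i)"
      by blast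
    let ?r = "u *\<^sub>R p + v *\<^sub>R q"
    have r: "blinfun_apply ?r (e i) = u * blinfun_apply p (e i) + v * blinfun_apply q (e i)"
      by (simp add: blinfun.add_left blinfun.scaleR_left)
    have "norm ?r \<le> u * norm p + v * norm q"
      using uv by (intro order_trans[OF norm_triangle_ineq]) simp
    also have "\<dots> \<le> blinfun_apply ?r (e i)"
      unfolding r using uv p(1) q(1) by (intro add_mono mult_left_mono)
    finally have 1: "norm ?r \<le> blinfun_apply ?r (e i)" .
    have "u *\<^sub>R g + v *\<^sub>R h - ?r = u *\<^sub>R (g - p) + v *\<^sub>R (h - q)"
      by (simp add: scaleR_diff_right)
    then have "norm (u *\<^sub>R g + v *\<^sub>R h - ?r) \<le> u * norm (g - p) + v * norm (h - q)"
      using uv norm_triangle_ineq[of "u *\<^sub>R (g - p)" "v *\<^sub>R (h - q)"] by simp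
    also have "\<dots> \<le> u * (1 - blinfun_apply p (e i)) + v * (1 - blinfun_apply q (e i))"
      using uv p(2) q(2) by (intro add_mono mult_left_mono)
    also have "\<dots> = 1 - blinfun_apply ?r (e i)"
      unfolding r using uv(3) by (simp add: algebra_simps)
    finally have 2: "norm (u *\<^sub>R g + v *\<^sub>R h - ?r) \<le> 1 - blinfun_apply ?r (e i)" .
    have 3: "blinfun_apply (u *\<^sub>R g + v *\<^sub>R h) (e i) \<le> blinfun_apply ?r (e i)"
      unfolding r using uv p(3) q(3)
      by (simp add: blinfun.add_left blinfun.scaleR_left add_mono mult_left_mono)
    show "u *\<^sub>R g + v *\<^sub>R h \<in> ?D" using 1 2 3 by blast
  qed
  ultimately have "convex hull sign_functionals n \<subseteq> ?D" by (rule hull_minimal)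
  then show ?thesis using assms(1) that by blast
qed

text \<open>For each \<open>n\<close> a convex combination of sign functionals agrees with
  \<open>f\<close> up to \<open>n\<close> and splits; the coefficients of the pieces converge along
  a subsequence, and the bounds survive because each finite combination involves only finitely many
  of them.\<close>

lemma functional_split:
  fixes f :: "'a \<Rightarrow>\<^sub>L real"
  assumes f: "norm f \<le> 1" and i: "i \<ge> 1"
  obtains p where "norm p \<le> blinfun_apply p (e i)" "norm (f - p) \<le> 1 - blinfun_apply p (e i)"
    "blinfun_apply f (e i) \<le> blinfun_apply p (e i)"
proof -
  have "\<exists>g p. (\<forall>j\<in>{1..n}. blinfun_apply g (e j) = blinfun_apply f (e j)) \<and>
      norm p \<le> blinfun_apply p (e i) \<and> norm (g - p) \<le> 1 - blinfun_apply p (e i) \<and>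
      blinfun_apply g (e i) \<le> blinfun_apply p (e i)" for n
  proof -
    obtain g where g: "g \<in> convex hull sign_functionals n"
      "\<And>j. j \<in> {1..n} \<Longrightarrow> blinfun_apply g (e j) = blinfun_apply f (e j)"
      using hull_sign_functionals_match[OF f] by blast
    show ?thesis using hull_sign_functionals_split[OF g(1) i] g(2) by metis
  qed
  then obtain G P where G: "\<And>n j. j \<in> {1..n} \<Longrightarrow> blinfun_apply (G n) (e j) = blinfun_apply f (e j)"
    and P: "\<And>n. norm (P n) \<le> blinfun_apply (P n) (e i)"
    and GP: "\<And>n. norm (G n - P n) \<le> 1 - blinfun_apply (P n) (e i)"
    and GPi: "\<And>n. blinfun_apply (G n) (e i) \<le> blinfun_apply (P n) (e i)"
    by metis
  have P1: "norm (P n) \<le> 1" for n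
    using P[of n] GP[of n] norm_ge_zero[of "G n - P n"] by linarith
  \<comment> \<open>The diagonal argument: one subsequence serves all coordinates, whose values stay
    in \<open>[-1, 1]\<close>.\<close>
  obtain k where k: "strict_mono (k :: nat \<Rightarrow> nat)"
    "\<And>j. j \<in> {1..} \<Longrightarrow> \<exists>l. (\<lambda>n. blinfun_apply (P (k n)) (e j)) \<longlonglongrightarrow> l"
  proof (rule function_convergent_subsequence[of "{1..}" "\<lambda>n j. blinfun_apply (P n) (e j)" 1])
    show "norm (blinfun_apply (P n) (e j)) \<le> 1" if "j \<in> {1..}" for n j
      using abs_functional_e_le[OF P1] that by simp
  qed auto
  obtain c where c: "\<And>j. j \<ge> 1 \<Longrightarrow> (\<lambda>n. blinfun_apply (P (k n)) (e j)) \<longlonglongrightarrow> c j"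
    using k(2) by (metis atLeast_iff)
  have kn: "n \<le> k n" for n using k(1) by (rule seq_suble)
  have ci: "c i \<ge> 0"
    using P norm_ge_zero order_trans by (intro LIMSEQ_le_const[OF c[OF i]]) blast
  \<comment> \<open>The norm of each piece is bounded by its own coefficient at \<open>i\<close>,
    which tends to \<open>c i\<close>; so the limit inherits the bound \<open>c i\<close>, its own
    coefficient at \<open>i\<close>.\<close>
  obtain p :: "'a \<Rightarrow>\<^sub>L real" where p: "norm p \<le> c i" "\<And>j. j \<ge> 1 \<Longrightarrow> blinfun_apply p (e j) = c j"
  proof (rule exists_functional[OF _ ci])
    fix n a
    have "(\<lambda>m. \<bar>\<Sum>j=1..n. a j * blinfun_apply (P (k m)) (e j)\<bar>) \<longlonglongrightarrow> \<bar>\<Sum>j=1..n. a j * c j\<bar>"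
      by (intro tendsto_intros c) auto
    moreover have "(\<lambda>m. blinfun_apply (P (k m)) (e i) * norm (\<Sum>j=1..n. a j *\<^sub>R e j))
        \<longlonglongrightarrow> c i * norm (\<Sum>j=1..n. a j *\<^sub>R e j)"
      by (intro tendsto_intros c i)
    ultimately show "\<bar>\<Sum>j=1..n. a j * c j\<bar> \<le> c i * norm (\<Sum>j=1..n. a j *\<^sub>R e j)"
      by (rule LIMSEQ_le) (use functional_combination_le[OF P] in blast)
  qed blast
  have "blinfun_apply f (e i) \<le> c i"
    using G[of i] GPi kn i by (intro LIMSEQ_le_const[OF c[OF i]] exI[of _ i]) (metis atLeastAtMost_iff order_trans)
  moreover have "norm (f - p) \<le> 1 - c i"
  proof (rule norm_functional_le)
    have "blinfun_apply (P (k n)) (e i) \<le> 1" for n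
      using GP[of "k n"] norm_ge_zero[of "G (k n) - P (k n)"] by linarith
    then have "c i \<le> 1" using LIMSEQ_le_const2[OF c[OF i]] by blast
    then show "0 \<le> 1 - c i" by simp
    fix n a
    let ?N = "norm (\<Sum>j=1..n. a j *\<^sub>R e j)"
    let ?d = "\<lambda>m j. blinfun_apply f (e j) - blinfun_apply (P (k m)) (e j)"
    \<comment> \<open>From \<open>m \<ge> n\<close> follows \<open>k m \<ge> n\<close>, so
      \<open>f\<close> may be replaced by \<open>G (k m)\<close> on the coordinates in the
      sum.\<close>
    have "\<bar>\<Sum>j=1..n. a j * ?d m j\<bar> \<le> (1 - blinfun_apply (P (k m)) (e i)) * ?N" if "m \<ge> n" for m
    proof -
      have "(\<Sum>j=1..n. a j * ?d m j) = (\<Sum>j=1..n. a j * blinfun_apply (G (k m) - P (k m)) (e j))"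
        using that kn[of m] by (intro sum.cong refl) (simp add: blinfun.diff_left G)
      then show ?thesis using functional_combination_le[OF GP[of "k m"], where n=n and a=a] by simp
    qed
    moreover have "(\<lambda>m. \<bar>\<Sum>j=1..n. a j * ?d m j\<bar>) \<longlonglongrightarrow> \<bar>\<Sum>j=1..n. a j * (blinfun_apply f (e j) - c j)\<bar>"
      by (intro tendsto_intros c) auto
    moreover have "(\<lambda>m. (1 - blinfun_apply (P (k m)) (e i)) * ?N) \<longlonglongrightarrow> (1 - c i) * ?N"
      by (intro tendsto_intros c i)
    ultimately have "\<bar>\<Sum>j=1..n. a j * (blinfun_apply f (e j) - c j)\<bar> \<le> (1 - c i) * ?N"
      by (intro LIMSEQ_le) auto
    moreover have "(\<Sum>j=1..n. a j * (blinfun_apply f (e j) - c j))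
        = (\<Sum>j=1..n. a j * blinfun_apply (f - p) (e j))"
      by (intro sum.cong refl) (simp add: blinfun.diff_left p(2))
    ultimately show "\<bar>\<Sum>j=1..n. a j * blinfun_apply (f - p) (e j)\<bar> \<le> (1 - c i) * ?N" by simp
  qed
  ultimately show ?thesis using that[of p] p i by simp
qed


section \<open>Coefficients of extreme points\<close>

lemma extreme_cballD:
  fixes f :: "'b::real_normed_vector"
  assumes "f extreme_point_of cball 0 1" "norm a \<le> 1" "norm b \<le> 1" "0 < u" "u < 1"
    "f = (1 - u) *\<^sub>R a + u *\<^sub>R b"
  shows "a = b"
proof (rule ccontr)
  assume "a \<noteq> b"
  then have "f \<in> open_segment a b" unfolding in_segment using assms by blast
  then show False using assms unfolding extreme_point_of_def by auto
qed

lemma extreme_cball_uminus: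
  fixes f :: "'b::real_normed_vector"
  assumes "f extreme_point_of cball 0 1"
  shows "(- f) extreme_point_of cball 0 1"
  unfolding extreme_point_of_def
proof (intro conjI ballI notI)
  show "- f \<in> cball 0 1" using assms unfolding extreme_point_of_def by simp
  fix a b :: 'b assume ab: "a \<in> cball 0 1" "b \<in> cball 0 1" "- f \<in> open_segment a b"
  then obtain u where u: "a \<noteq> b" "0 < u" "u < 1" "- f = (1 - u) *\<^sub>R a + u *\<^sub>R b"
    unfolding in_segment by blast
  have "f = - ((1 - u) *\<^sub>R a + u *\<^sub>R b)" using u(4) by (metis minus_minus)
  then have "f = (1 - u) *\<^sub>R (- a) + u *\<^sub>R (- b)" by simp
  then have "- a = - b" using extreme_cballD[OF assms _ _ u(2,3), of "- a" "- b"] ab by simp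
  then show False using u(1) by simp
qed

text \<open>With \<open>t\<close> the coefficient of the piece \<open>p\<close> at \<open>i\<close>,
  the rescaled pieces \<open>p / t\<close> and \<open>(f - p) / (1 - t)\<close> lie in the ball and
  average to \<open>f\<close>. Extremality makes them equal, and the first has coefficient 1 at
  \<open>i\<close>. The endpoints \<open>t = 0\<close> and \<open>t = 1\<close> are read off
  directly.\<close>

lemma extreme_coeff:
  fixes f :: "'a \<Rightarrow>\<^sub>L real"
  assumes f: "f extreme_point_of cball 0 1" and i: "i \<ge> 1"
  shows "blinfun_apply f (e i) = 1 \<or> blinfun_apply f (e i) \<le> 0"
proof -
  have "norm f \<le> 1" using f unfolding extreme_point_of_def by simp
  then obtain p where p: "norm p \<le> blinfun_apply p (e i)" "norm (f - p) \<le> 1 - blinfun_apply p (e i)"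
    "blinfun_apply f (e i) \<le> blinfun_apply p (e i)"
    using i by (rule functional_split)
  define t where "t = blinfun_apply p (e i)"
  have "0 \<le> t" "t \<le> 1"
    using p norm_ge_zero[of p] norm_ge_zero[of "f - p"] unfolding t_def by linarith+
  then consider "t = 0" | "t = 1" | "0 < t" "t < 1" by linarith
  then show ?thesis
  proof cases
    case 1
    then show ?thesis using p(3) t_def by simp
  next
    case 2
    then have "f = p" using p(2) t_def by simp
    then show ?thesis using 2 t_def by simp
  next
    case 3
    have "(1 / (1 - t)) *\<^sub>R (f - p) = (1 / t) *\<^sub>R p"
    proof (rule extreme_cballD[OF f _ _ 3])
      show "norm ((1 / (1 - t)) *\<^sub>R (f - p)) \<le> 1" "norm ((1 / t) *\<^sub>R p) \<le> 1"
        using p 3 by (simp_all add: t_def)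
      show "f = (1 - t) *\<^sub>R (1 / (1 - t)) *\<^sub>R (f - p) + t *\<^sub>R (1 / t) *\<^sub>R p"
        using 3 by simp
    qed
    then have "blinfun_apply ((1 / (1 - t)) *\<^sub>R (f - p)) (e i) = blinfun_apply ((1 / t) *\<^sub>R p) (e i)"
      by simp
    then have "(blinfun_apply f (e i) - t) / (1 - t) = 1"
      using 3 by (simp add: blinfun.scaleR_left blinfun.diff_left t_def)
    then have "blinfun_apply f (e i) = 1" using 3 by (simp add: field_simps)
    then show ?thesis by simp
  qed
qed

section \<open>Functionals with signs on a maximal member\<close>

definition supp :: "('a \<Rightarrow>\<^sub>L real) \<Rightarrow> nat set" where
  "supp f = {i. i \<ge> 1 \<and> blinfun_apply f (e i) \<noteq> 0}"

text \<open>Maximality is phrased by one-point extensions; by heredity this is maximality under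
  inclusion in \<open>\<A>\<close>.\<close>

definition maximal_signed :: "('a \<Rightarrow>\<^sub>L real) \<Rightarrow> bool" where
  "maximal_signed f \<longleftrightarrow> norm f \<le> 1 \<and> (\<forall>i\<ge>1. blinfun_apply f (e i) \<in> {-1, 0, 1}) \<and>
     supp f \<in> \<A> \<and> (\<forall>j\<ge>1. insert j (supp f) \<in> \<A> \<longrightarrow> j \<in> supp f)"

lemma extreme_imp_maximal_signed:
  fixes f :: "'a \<Rightarrow>\<^sub>L real"
  assumes f: "f extreme_point_of cball 0 1"
  shows "maximal_signed f"
proof -
  have norm: "norm f \<le> 1" using f unfolding extreme_point_of_def by simp
  have sign: "blinfun_apply f (e i) \<in> {-1, 0, 1}" if "i \<ge> 1" for i
  proof -
    have "blinfun_apply f (e i) = 1 \<or> blinfun_apply f (e i) \<le> 0"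
      "- blinfun_apply f (e i) = 1 \<or> - blinfun_apply f (e i) \<le> 0"
      using extreme_coeff[OF f that] extreme_coeff[OF extreme_cball_uminus[OF f] that]
      by (simp_all add: blinfun.minus_left)
    then show ?thesis by auto
  qed
  have supp: "supp f \<in> \<A>"
  proof (rule memberI)
    show "supp f \<subseteq> {1..}" unfolding supp_def by auto
    fix F assume F: "F \<subseteq> supp f" "finite F"
    have F1: "F \<subseteq> {1..}" using F unfolding supp_def by auto
    have sq: "blinfun_apply f (e i) * blinfun_apply f (e i) = 1" if "i \<in> F" for i
      using that F sign[of i] unfolding supp_def by fastforce
    show "F \<in> \<A>"
    proof (rule ccontr)
      assume "F \<notin> \<A>"
      \<comment> \<open>On this vector \<open>f\<close> takes the value \<open>card F\<close>,
        because its coefficients on \<open>F\<close> are signs, while the norm is at most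
        \<open>card F - 1\<close>.\<close>
      then have le: "norm (\<Sum>i\<in>F. blinfun_apply f (e i) *\<^sub>R e i) \<le> real (card F) - 1"
        using abs_functional_e_le[OF norm] F1 by (intro norm_nonmember_combination_le F) auto
      have "real (card F) = blinfun_apply f (\<Sum>i\<in>F. blinfun_apply f (e i) *\<^sub>R e i)"
        by (simp add: blinfun.sum_right blinfun.scaleR_right sq)
      also have "\<dots> \<le> norm f * norm (\<Sum>i\<in>F. blinfun_apply f (e i) *\<^sub>R e i)"
        using norm_blinfun[of f "\<Sum>i\<in>F. blinfun_apply f (e i) *\<^sub>R e i"] by simp
      also have "\<dots> \<le> norm (\<Sum>i\<in>F. blinfun_apply f (e i) *\<^sub>R e i)"
        using norm by (simp add: mult_left_le_one_le)
      finally show False using le by simp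
    qed
  qed
  have "j \<in> supp f" if j: "j \<ge> 1" "insert j (supp f) \<in> \<A>" for j
  proof (rule ccontr)
    assume nj: "j \<notin> supp f"
    \<comment> \<open>As \<open>insert j (supp f)\<close> is a member, the coefficient at
      \<open>j\<close> may be any \<open>s\<close> in \<open>[-1, 1]\<close> without leaving the
      ball; the choices 1 and -1 have midpoint \<open>f\<close>.\<close>
    have ex: "\<exists>g :: 'a \<Rightarrow>\<^sub>L real. norm g \<le> 1 \<and>
        (\<forall>i\<ge>1. blinfun_apply g (e i) = (if i = j then s else blinfun_apply f (e i)))"
      if s: "\<bar>s\<bar> \<le> 1" for s :: real
    proof -
      let ?c = "\<lambda>i. if i = j then s else blinfun_apply f (e i)"
      have "\<bar>\<Sum>i=1..n. a i * ?c i\<bar> \<le> 1 * norm (\<Sum>i=1..n. a i *\<^sub>R e i)" for n a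
        using member_combination_le[OF j(2), of ?c a n] s abs_functional_e_le[OF norm]
        by (simp add: supp_def)
      then show ?thesis using exists_functional[of ?c 1] by (metis zero_le_one)
    qed
    obtain g h :: "'a \<Rightarrow>\<^sub>L real" where g: "norm g \<le> 1"
      "\<And>i. i \<ge> 1 \<Longrightarrow> blinfun_apply g (e i) = (if i = j then 1 else blinfun_apply f (e i))"
      and h: "norm h \<le> 1"
      "\<And>i. i \<ge> 1 \<Longrightarrow> blinfun_apply h (e i) = (if i = j then - 1 else blinfun_apply f (e i))"
      using ex[of 1] ex[of "-1"] by auto
    have "f = (1 - 1/2) *\<^sub>R g + (1/2) *\<^sub>R h"
    proof (rule functional_eqI)
      fix i :: nat assume "i \<ge> 1"
      then show "blinfun_apply f (e i) = blinfun_apply ((1 - 1/2) *\<^sub>R g + (1/2) *\<^sub>R h) (e i)"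
        using nj g(2)[of i] h(2)[of i]
        by (auto simp: blinfun.add_left blinfun.scaleR_left supp_def)
    qed
    then have "g = h" by (rule extreme_cballD[OF f g(1) h(1), rotated 2]) auto
    then show False using g(2)[OF j(1)] h(2)[OF j(1)] by simp
  qed
  then show ?thesis using norm sign supp unfolding maximal_signed_def by blast
qed

text \<open>The empty set extends to \<open>{1}\<close> and so is never maximal. This keeps the
  later normalising constants positive.\<close>

lemma maximal_signed_supp_nonempty:
  assumes "maximal_signed f"
  shows "supp f \<noteq> {}"
  using assms singleton_member[of 1] unfolding maximal_signed_def by force

lemma maximal_signed_square:
  assumes "maximal_signed f" "i \<in> supp f"
  shows "blinfun_apply f (e i) * blinfun_apply f (e i) = 1"
  using assms unfolding maximal_signed_def supp_def by auto

text \<open>Off the support, compactness of \<open>\<A>\<close> supplies a finite obstruction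
  \<open>F\<close> to adding \<open>j\<close>. A sign vector on \<open>F\<close> has norm at most
  \<open>card F - 1\<close>, which \<open>g\<close> already uses up on \<open>F - {j}\<close>,
  leaving nothing for \<open>j\<close>.\<close>

lemma maximal_signed_determined:
  assumes f: "maximal_signed f" and g: "norm g \<le> 1"
    and eq: "\<And>i. i \<in> supp f \<Longrightarrow> blinfun_apply g (e i) = blinfun_apply f (e i)"
  shows "g = f"
proof (rule functional_eqI)
  fix j :: nat assume j: "j \<ge> 1"
  show "blinfun_apply g (e j) = blinfun_apply f (e j)"
  proof (cases "j \<in> supp f")
    case False
    then have "insert j (supp f) \<notin> \<A>" using f j unfolding maximal_signed_def by blast
    moreover have "insert j (supp f) \<subseteq> {1..}" using j unfolding supp_def by auto
    ultimately obtain F where F: "F \<subseteq> insert j (supp f)" "finite F" "F \<notin> \<A>"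
      using memberI by blast
    \<comment> \<open>Without \<open>j\<close>, the set \<open>F\<close> would lie in the support
      and be a member by heredity.\<close>
    have jF: "j \<in> F"
      using F f hereditary unfolding maximal_signed_def by blast
    have F1: "F \<subseteq> {1..}" using F j unfolding supp_def by auto
    let ?s = "\<lambda>i. if i = j then sgn (blinfun_apply g (e j)) else blinfun_apply f (e i)"
    let ?x = "\<Sum>i\<in>F. ?s i *\<^sub>R e i"
    have "\<bar>?s i\<bar> \<le> 1" if "i \<in> F" for i
      using f F1 that abs_functional_e_le[of f 1 i] unfolding maximal_signed_def by (auto simp: sgn_if)
    then have le: "norm ?x \<le> real (card F) - 1"
      using F F1 by (intro norm_nonmember_combination_le) auto
    have "blinfun_apply g ?x = (\<Sum>i\<in>F. ?s i * blinfun_apply g (e i))"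
      by (simp add: blinfun.sum_right blinfun.scaleR_right)
    also have "\<dots> = \<bar>blinfun_apply g (e j)\<bar> + (\<Sum>i\<in>F - {j}. ?s i * blinfun_apply g (e i))"
      using F(2) jF by (subst sum.remove[of F j]) (auto simp: mult.commute[of "sgn _"] abs_sgn)
    also have "(\<Sum>i\<in>F - {j}. ?s i * blinfun_apply g (e i)) = (\<Sum>i\<in>F - {j}. 1)"
      using F(1) by (intro sum.cong refl) (auto simp: eq maximal_signed_square[OF f])
    also have "\<dots> = real (card F) - 1"
      using F(2) jF by (simp add: card_Diff_singleton of_nat_diff Suc_leI card_gt_0_iff)
        (metis One_nat_def Suc_leI card_gt_0_iff empty_iff of_nat_1 of_nat_diff)
    finally have "\<bar>blinfun_apply g (e j)\<bar> + (real (card F) - 1) = blinfun_apply g ?x" by simp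
    also have "\<dots> \<le> norm g * norm ?x" using norm_blinfun[of g ?x] by simp
    also have "\<dots> \<le> norm ?x" using g by (simp add: mult_left_le_one_le)
    finally have "blinfun_apply g (e j) = 0" using le by simp
    then show ?thesis using False j unfolding supp_def by simp
  qed (use eq in simp)
qed


section \<open>Exposing and strongly exposing vectors\<close>

lemma maximal_signed_imp_exposed:
  assumes f: "maximal_signed f"
  shows "weak_star_exposed f"
proof -
  have norm: "norm f \<le> 1" using f unfolding maximal_signed_def by blast
  have sign: "blinfun_apply f (e i) \<in> {-1, 0, 1}" if "i \<ge> 1" for i
    using f that unfolding maximal_signed_def by blast
  \<comment> \<open>Series start at 0 and the basis at 1, hence the shift. The weights
    \<open>(1/2) ^ k\<close> give convergence while leaving every support coordinate a positive
    share; \<open>w k\<close> is the value of \<open>f\<close> at \<open>v k\<close>.\<close>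
  let ?f = "\<lambda>k. blinfun_apply f (e (Suc k))"
  define v where "v k = ((1/2) ^ k * ?f k) *\<^sub>R e (Suc k)" for k
  define w where "w k = (1/2) ^ k * (?f k)\<^sup>2" for k
  have sq: "\<bar>?f k\<bar> = (?f k)\<^sup>2" for k using sign[of "Suc k"] by auto
  have vw: "norm (v k) \<le> w k" for k
    using norm_e_le[of "Suc k"] unfolding v_def w_def sq[symmetric]
    by (simp add: abs_mult mult_left_le)
  have w0: "w k \<ge> 0" for k by (simp add: w_def)
  have "w k \<le> (1/2) ^ k" for k
    using abs_functional_e_le[OF norm, of "Suc k"] unfolding w_def sq[symmetric]
    by (simp add: mult_left_le)
  then have sw: "summable w"
    using w0 by (intro summable_comparison_test'[of "\<lambda>k. (1/2::real) ^ k" 0 w]) (auto simp: summable_geometric)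
  have snv: "summable (\<lambda>k. norm (v k))"
    using vw by (intro summable_comparison_test'[OF sw, of 0]) auto
  have sv: "summable v" using snv by (rule summable_norm_cancel)
  define z where "z = suminf v"
  define s where "s = suminf w"
  have apply_z: "blinfun_apply g z = (\<Sum>k. (1/2) ^ k * (?f k * blinfun_apply g (e (Suc k))))"
    "summable (\<lambda>k. (1/2) ^ k * (?f k * blinfun_apply g (e (Suc k))))" for g :: "'a \<Rightarrow>\<^sub>L real"
    using bounded_linear.suminf[OF blinfun.bounded_linear_right sv, of g]
      bounded_linear.summable[OF blinfun.bounded_linear_right sv, of g]
    by (simp_all add: z_def v_def[abs_def] blinfun.scaleR_right mult.assoc)
  have fz: "blinfun_apply f z = s"
    unfolding apply_z(1) s_def by (intro suminf_cong) (simp add: w_def power2_eq_square)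
  have "norm z \<le> (\<Sum>k. norm (v k))" unfolding z_def by (rule summable_norm[OF snv])
  also have "\<dots> \<le> s" unfolding s_def by (rule suminf_le[OF vw snv sw])
  finally have zs: "norm z \<le> s" .
  have below: "blinfun_apply g z \<le> norm z" if "norm g \<le> 1" for g :: "'a \<Rightarrow>\<^sub>L real"
    using norm_blinfun[of g z] mult_right_mono[OF that norm_ge_zero[of z]] by simp
  \<comment> \<open>The triangle inequality gives norm at most \<open>s\<close>, and
    \<open>f\<close>, of norm at most 1, attains \<open>s\<close>.\<close>
  have nz: "norm z = s" using zs below[OF norm] fz by simp
  obtain i where i: "i \<in> supp f" using maximal_signed_supp_nonempty[OF f] by blast
  then obtain k where k: "i = Suc k" unfolding supp_def by (cases i) auto
  have "w k > 0" using i unfolding k w_def supp_def by simp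
  then have s: "s > 0" unfolding s_def by (rule suminf_pos2[OF sw w0])
  let ?x = "(1 / s) *\<^sub>R z"
  have "blinfun_apply g ?x < 1" if g: "norm g \<le> 1" "g \<noteq> f" for g :: "'a \<Rightarrow>\<^sub>L real"
  proof (rule ccontr)
    assume "\<not> blinfun_apply g ?x < 1"
    then have "blinfun_apply g z = s"
      using below[OF g(1)] nz s by (simp add: blinfun.scaleR_right field_simps)
    \<comment> \<open>If \<open>g\<close> also attains \<open>s\<close>, the termwise differences
      are nonnegative and sum to 0, so all vanish and \<open>g\<close> agrees with \<open>f\<close>
      on the support.\<close>
    then have "(\<Sum>k. (1/2) ^ k * (?f k * blinfun_apply f (e (Suc k)))
        - (1/2) ^ k * (?f k * blinfun_apply g (e (Suc k)))) = 0"
      using fz suminf_diff[OF apply_z(2)[of f] apply_z(2)[of g]] by (simp add: apply_z(1))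
    moreover have "(1/2) ^ k * (?f k * blinfun_apply f (e (Suc k)))
        - (1/2) ^ k * (?f k * blinfun_apply g (e (Suc k))) \<ge> 0" for k
    proof -
      have "?f k * blinfun_apply g (e (Suc k)) \<le> \<bar>?f k\<bar> * \<bar>blinfun_apply g (e (Suc k))\<bar>"
        by (metis abs_ge_self abs_mult)
      also have "\<dots> \<le> \<bar>?f k\<bar>"
        using abs_functional_e_le[OF g(1), of "Suc k"] by (simp add: mult_left_le)
      also have "\<dots> = ?f k * ?f k" using sq by (simp add: power2_eq_square)
      finally show ?thesis by simp
    qed
    ultimately have zero: "(1/2) ^ k * (?f k * blinfun_apply f (e (Suc k)))
        - (1/2) ^ k * (?f k * blinfun_apply g (e (Suc k))) = 0" for k
      using suminf_eq_zero_iff[OF summable_diff[OF apply_z(2)[of f] apply_z(2)[of g]]] by blast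
    have eq: "?f k * blinfun_apply g (e (Suc k)) = ?f k * ?f k" for k
      using zero[of k] by auto
    have "blinfun_apply g (e i) = blinfun_apply f (e i)" if "i \<in> supp f" for i
      using that eq[of "i - 1"] unfolding supp_def by simp
    then show False using maximal_signed_determined[OF f g(1)] g(2) by blast
  qed
  moreover have "norm ?x = 1" "blinfun_apply f ?x = 1"
    using s nz fz by (simp_all add: blinfun.scaleR_right)
  ultimately show ?thesis using norm unfolding weak_star_exposed_def by (intro conjI bexI[of _ ?x]) auto
qed

text \<open>A quantitative form of \<open>maximal_signed_determined\<close>. The coordinates on the
  support and those off it each contribute at most the deficit \<open>\<delta>\<close>, whence the
  factor 2.\<close>

lemma maximal_signed_finite_estimate:
  assumes f: "maximal_signed f" and fin: "finite (supp f)" and g: "norm g \<le> 1"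
  shows "norm (g - f) \<le> 2 * (\<Sum>i\<in>supp f. 1 - blinfun_apply f (e i) * blinfun_apply g (e i))"
proof -
  let ?S = "supp f"
  define \<delta> where "\<delta> = (\<Sum>i\<in>?S. 1 - blinfun_apply f (e i) * blinfun_apply g (e i))"
  have S1: "?S \<subseteq> {1..}" unfolding supp_def by auto
  have f1: "\<bar>blinfun_apply f (e i)\<bar> = 1" if "i \<in> ?S" for i
    using f that unfolding maximal_signed_def supp_def by auto
  \<comment> \<open>With \<open>f (e i)\<close> a sign and \<open>g (e i)\<close> in
    \<open>[-1, 1]\<close>, the distance is the deficit exactly.\<close>
  have dist: "\<bar>blinfun_apply (g - f) (e i)\<bar> = 1 - blinfun_apply f (e i) * blinfun_apply g (e i)"
    if "i \<in> ?S" for i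
    using f1[OF that] abs_functional_e_le[OF g, of i] that S1
    by (auto simp: abs_if blinfun.diff_left split: if_splits)
  have \<delta>0: "\<delta> \<ge> 0" unfolding \<delta>_def using dist by (intro sum_nonneg) (metis abs_ge_zero)
  have "norm (g - f) \<le> 2 * \<delta>"
  proof (rule norm_functional_le)
    fix n a
    define M where "M = norm (\<Sum>i=1..n. a i *\<^sub>R e i)"
    let ?T = "{1..n} - ?S"
    have M0: "M \<ge> 0" unfolding M_def by simp
    \<comment> \<open>\<open>g\<close> is tested on \<open>M\<close> times the signs of \<open>f\<close> on \<open>S\<close>, perturbed by the part of \<open>a\<close> off \<open>S\<close>:
      a member of \<open>\<A>\<close> that meets the perturbation misses a point of \<open>S\<close>, so the norm stays at
      most \<open>M |S|\<close>.\<close>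
    have tail: "\<sigma> * (\<Sum>i\<in>?T. a i * blinfun_apply g (e i)) \<le> \<delta> * M" if \<sigma>: "\<bar>\<sigma>\<bar> = 1" for \<sigma> :: real
    proof -
      let ?c = "\<lambda>i. if i \<in> ?S then M * blinfun_apply f (e i) else \<sigma> * a i"
      let ?x = "\<Sum>i\<in>?S \<union> ?T. ?c i *\<^sub>R e i"
      have "norm ?x \<le> M * real (card ?S)"
      proof (rule norm_finite_combination_le)
        fix A assume A: "A \<in> \<A>"
        have "(\<Sum>i\<in>A \<inter> (?S \<union> ?T). \<bar>?c i\<bar>) = (\<Sum>i\<in>(A \<inter> ?S) \<union> (A \<inter> ?T). \<bar>?c i\<bar>)"
          by (simp only: Int_Un_distrib)
        also have "\<dots> = (\<Sum>i\<in>A \<inter> ?S. \<bar>?c i\<bar>) + (\<Sum>i\<in>A \<inter> ?T. \<bar>?c i\<bar>)"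
          using fin by (intro sum.union_disjoint) auto
        also have "(\<Sum>i\<in>A \<inter> ?S. \<bar>?c i\<bar>) = M * real (card (A \<inter> ?S))"
          using M0 f1 by (simp add: abs_mult)
        also have "(\<Sum>i\<in>A \<inter> ?T. \<bar>?c i\<bar>) = (\<Sum>i\<in>A \<inter> ?T. \<bar>a i\<bar>)"
          using \<sigma> by (intro sum.cong) (auto simp: abs_mult)
        also have "M * real (card (A \<inter> ?S)) + (\<Sum>i\<in>A \<inter> ?T. \<bar>a i\<bar>) \<le> M * real (card ?S)"
        proof (cases "?S \<subseteq> A")
          case True
          have "A \<subseteq> ?S"
          proof
            fix j assume "j \<in> A"
            then have "insert j ?S \<in> \<A>" "j \<ge> 1"
              using True hereditary[OF A] positive_members[OF A] by auto
            then show "j \<in> ?S" using f unfolding maximal_signed_def by blast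
          qed
          then have "A \<inter> ?T = {}" "A \<inter> ?S = ?S" using True by auto
          then show ?thesis by simp
        next
          case False
          then have "card (A \<inter> ?S) < card ?S" using fin by (intro psubset_card_mono) auto
          then have "M * real (card (A \<inter> ?S)) \<le> M * (real (card ?S) - 1)"
            using M0 by (intro mult_left_mono) auto
          moreover have "(\<Sum>i\<in>A \<inter> ?T. \<bar>a i\<bar>) \<le> (\<Sum>i\<in>A \<inter> {1..n}. \<bar>a i\<bar>)"
            by (intro sum_mono2) auto
          then have "(\<Sum>i\<in>A \<inter> ?T. \<bar>a i\<bar>) \<le> M"
            using sum_abs_le_norm[OF A, where n=n and a=a] unfolding M_def by linarith
          ultimately show ?thesis by (simp add: algebra_simps)
        qed
        finally show "(\<Sum>i\<in>A \<inter> (?S \<union> ?T). \<bar>?c i\<bar>) \<le> M * real (card ?S)" .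
      qed (use fin S1 in auto)
      moreover have "blinfun_apply g ?x \<le> norm ?x"
        using norm_blinfun[of g ?x] mult_right_mono[OF g norm_ge_zero[of ?x]] by simp
      moreover have "blinfun_apply g ?x = (\<Sum>i\<in>?S \<union> ?T. ?c i * blinfun_apply g (e i))"
        by (simp add: blinfun.sum_right blinfun.scaleR_right)
      moreover have "\<dots> = (\<Sum>i\<in>?S. ?c i * blinfun_apply g (e i)) + (\<Sum>i\<in>?T. ?c i * blinfun_apply g (e i))"
        using fin by (intro sum.union_disjoint) auto
      moreover have "(\<Sum>i\<in>?S. ?c i * blinfun_apply g (e i))
          = M * (\<Sum>i\<in>?S. blinfun_apply f (e i) * blinfun_apply g (e i))"
        by (simp add: sum_distrib_left mult.assoc)
      moreover have "(\<Sum>i\<in>?T. ?c i * blinfun_apply g (e i)) = \<sigma> * (\<Sum>i\<in>?T. a i * blinfun_apply g (e i))"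
        unfolding sum_distrib_left by (intro sum.cong) auto
      moreover have "\<delta> * M = M * real (card ?S) - M * (\<Sum>i\<in>?S. blinfun_apply f (e i) * blinfun_apply g (e i))"
        by (simp add: \<delta>_def sum_subtractf algebra_simps)
      ultimately show ?thesis by linarith
    qed
    have "\<bar>\<Sum>i\<in>{1..n} \<inter> ?S. a i * blinfun_apply (g - f) (e i)\<bar>
        \<le> (\<Sum>i\<in>{1..n} \<inter> ?S. M * \<bar>blinfun_apply (g - f) (e i)\<bar>)"
      using abs_coeff_le_norm[where n=n and a=a] unfolding M_def
      by (intro order_trans[OF sum_abs] sum_mono) (auto simp: abs_mult intro!: mult_right_mono)
    also have "\<dots> \<le> (\<Sum>i\<in>?S. M * \<bar>blinfun_apply (g - f) (e i)\<bar>)"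
      using fin M0 by (intro sum_mono2) auto
    also have "\<dots> = \<delta> * M"
      unfolding \<delta>_def by (simp add: dist sum_distrib_left[symmetric] mult.commute)
    finally have head: "\<bar>\<Sum>i\<in>{1..n} \<inter> ?S. a i * blinfun_apply (g - f) (e i)\<bar> \<le> \<delta> * M" .
    have "(\<Sum>i\<in>?T. a i * blinfun_apply (g - f) (e i)) = (\<Sum>i\<in>?T. a i * blinfun_apply g (e i))"
      by (intro sum.cong) (auto simp: supp_def blinfun.diff_left)
    then have "\<bar>\<Sum>i\<in>?T. a i * blinfun_apply (g - f) (e i)\<bar> \<le> \<delta> * M"
      using tail[of 1] tail[of "-1"] by (simp add: abs_le_iff)
    moreover have "(\<Sum>i=1..n. a i * blinfun_apply (g - f) (e i))
        = (\<Sum>i\<in>{1..n} \<inter> ?S. a i * blinfun_apply (g - f) (e i))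
          + (\<Sum>i\<in>?T. a i * blinfun_apply (g - f) (e i))"
      by (rule sum.Int_Diff) simp
    ultimately show "\<bar>\<Sum>i=1..n. a i * blinfun_apply (g - f) (e i)\<bar>
        \<le> 2 * \<delta> * norm (\<Sum>i=1..n. a i *\<^sub>R e i)"
      using head unfolding M_def by linarith
  qed (use \<delta>0 in simp)
  then show ?thesis unfolding \<delta>_def .
qed

text \<open>For the averaged sign vector \<open>x\<close> the deficit in the previous estimate is
  \<open>N * (1 - blinfun_apply g x)\<close>, so convergence at \<open>x\<close> forces convergence
  in norm.\<close>

lemma maximal_signed_imp_strongly_exposed:
  assumes f: "maximal_signed f" and fin: "finite (supp f)"
  shows "weak_star_strongly_exposed f"
proof -
  let ?S = "supp f"
  define N where "N = real (card ?S)"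
  define x where "x = (1 / N) *\<^sub>R (\<Sum>i\<in>?S. blinfun_apply f (e i) *\<^sub>R e i)"
  have norm: "norm f \<le> 1" using f unfolding maximal_signed_def by blast
  have S1: "?S \<subseteq> {1..}" unfolding supp_def by auto
  have N: "N > 0"
    using maximal_signed_supp_nonempty[OF f] fin unfolding N_def by (simp add: card_gt_0_iff)
  have apply_x: "N * (1 - blinfun_apply g x)
      = (\<Sum>i\<in>?S. 1 - blinfun_apply f (e i) * blinfun_apply g (e i))" for g :: "'a \<Rightarrow>\<^sub>L real"
    using N by (simp add: x_def blinfun.scaleR_right blinfun.sum_right sum_subtractf
        right_diff_distrib N_def[symmetric])
  have fx: "blinfun_apply f x = 1"
    using apply_x[of f] N by (simp add: maximal_signed_square[OF f])
  have "norm (blinfun_apply f (e i) *\<^sub>R e i) \<le> 1" if "i \<in> ?S" for i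
    using abs_functional_e_le[OF norm] norm_e_le that S1 by (auto intro!: mult_le_one)
  then have "norm (\<Sum>i\<in>?S. blinfun_apply f (e i) *\<^sub>R e i) \<le> N"
    using sum_norm_le[of ?S "\<lambda>i. blinfun_apply f (e i) *\<^sub>R e i" "\<lambda>_. 1"] by (simp add: N_def)
  then have "norm x \<le> 1" using N by (simp add: x_def)
  moreover have "1 \<le> norm x"
    using norm_blinfun[of f x] mult_right_mono[OF norm norm_ge_zero[of x]] fx by simp
  ultimately have nx: "norm x = 1" by simp
  have "(\<lambda>n. norm (F n - f)) \<longlonglongrightarrow> 0"
    if F: "range F \<subseteq> cball 0 1" "(\<lambda>n. blinfun_apply (F n) x) \<longlonglongrightarrow> 1" for F :: "nat \<Rightarrow> 'a \<Rightarrow>\<^sub>L real"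
  proof (rule tendsto_sandwich[OF _ _ tendsto_const])
    have "norm (F n - f) \<le> 2 * (N * (1 - blinfun_apply (F n) x))" for n
      using maximal_signed_finite_estimate[OF f fin, of "F n"] F(1) unfolding apply_x by (auto simp: image_subset_iff)
    then show "\<forall>\<^sub>F n in sequentially. norm (F n - f) \<le> 2 * (N * (1 - blinfun_apply (F n) x))"
      by simp
    have "(\<lambda>n. 2 * (N * (1 - blinfun_apply (F n) x))) \<longlonglongrightarrow> 2 * (N * (1 - 1))"
      by (intro tendsto_intros F(2))
    then show "(\<lambda>n. 2 * (N * (1 - blinfun_apply (F n) x))) \<longlonglongrightarrow> 0" by simp
  qed simp
  then show ?thesis
    using norm nx fx unfolding weak_star_strongly_exposed_def by (intro conjI bexI[of _ x]) auto
qed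

end

section \<open>Converse implications and conclusion\<close>

text \<open>Both endpoints of a proper segment through \<open>f\<close> take values below 1 at the
  exposing vector, hence so would \<open>f\<close>.\<close>

lemma weak_star_exposed_imp_extreme:
  fixes f :: "'a::real_normed_vector \<Rightarrow>\<^sub>L real"
  assumes "weak_star_exposed f"
  shows "f extreme_point_of cball 0 1"
  unfolding extreme_point_of_def
proof (intro conjI ballI notI)
  show "f \<in> cball 0 1" using assms unfolding weak_star_exposed_def by blast
  obtain x where x: "blinfun_apply f x = 1"
    "\<And>g. g \<in> cball 0 1 \<Longrightarrow> g \<noteq> f \<Longrightarrow> blinfun_apply g x < 1"
    using assms unfolding weak_star_exposed_def by blast
  fix a b assume ab: "a \<in> cball 0 1" "b \<in> cball 0 1" "f \<in> open_segment a b"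
  then obtain u where u: "a \<noteq> b" "0 < u" "u < 1" "f = (1 - u) *\<^sub>R a + u *\<^sub>R b"
    unfolding in_segment by blast
  have "a \<noteq> f" "b \<noteq> f" using ab(3) by (auto simp: open_segment_def)
  then have "(1 - u) * blinfun_apply a x + u * blinfun_apply b x < (1 - u) * 1 + u * 1"
    using u ab x(2) by (intro add_strict_mono mult_strict_left_mono) auto
  moreover have "blinfun_apply f x = (1 - u) * blinfun_apply a x + u * blinfun_apply b x"
    unfolding u(4) by (simp add: blinfun.add_left blinfun.scaleR_left)
  ultimately show False using x(1) by simp
qed

text \<open>A second functional in the ball with value 1 at \<open>x\<close>, taken as a constant
  sequence, would have to converge to \<open>f\<close>.\<close>

lemma weak_star_strongly_exposed_imp_exposed:
  fixes f :: "'a::real_normed_vector \<Rightarrow>\<^sub>L real"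
  assumes "weak_star_strongly_exposed f"
  shows "weak_star_exposed f"
proof -
  obtain x where f: "f \<in> cball 0 1" and x: "x \<in> sphere 0 1" "blinfun_apply f x = 1"
    and conv: "\<And>F :: nat \<Rightarrow> 'a \<Rightarrow>\<^sub>L real. range F \<subseteq> cball 0 1 \<Longrightarrow>
      (\<lambda>n. blinfun_apply (F n) x) \<longlonglongrightarrow> 1 \<Longrightarrow> (\<lambda>n. norm (F n - f)) \<longlonglongrightarrow> 0"
    using assms unfolding weak_star_strongly_exposed_def by blast
  have "blinfun_apply g x < 1" if g: "g \<in> cball 0 1" "g \<noteq> f" for g
  proof -
    have "blinfun_apply g x \<le> 1"
      using norm_blinfun[of g x] g(1) x(1) by simp
    moreover have "blinfun_apply g x \<noteq> 1"
    proof
      assume "blinfun_apply g x = 1"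
      then have "(\<lambda>n :: nat. norm (g - f)) \<longlonglongrightarrow> 0"
        using conv[of "\<lambda>_. g"] g(1) by auto
      then show False using g(2) by (simp add: LIMSEQ_const_iff)
    qed
    ultimately show ?thesis by simp
  qed
  then show ?thesis using f x unfolding weak_star_exposed_def by blast
qed

theorem proposition4p4:
  fixes \<A> :: "nat set set"
    and e :: "nat \<Rightarrow> 'a::banach"
    and x' :: "'a \<Rightarrow>\<^sub>L real"
  assumes "adequate_family \<A>"
    and "is_h_space \<A> e"
    and "x' \<in> cball 0 1"
  shows "(x' extreme_point_of cball 0 1 \<longleftrightarrow> weak_star_exposed x') \<and>
    ((\<forall>A\<in>\<A>. finite A) \<longrightarrow>
       (x' extreme_point_of cball 0 1 \<longleftrightarrow> weak_star_strongly_exposed x'))"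
proof -
  interpret h_space \<A> e using assms(1,2) by unfold_locales
  \<comment> \<open>The support is itself a member of \<open>\<A>\<close>, hence finite
    here.\<close>
  have "weak_star_strongly_exposed x'" if "\<forall>A\<in>\<A>. finite A" "x' extreme_point_of cball 0 1"
    using extreme_imp_maximal_signed[OF that(2)] that(1) maximal_signed_imp_strongly_exposed
    unfolding maximal_signed_def by blast
  then show ?thesis
    using extreme_imp_maximal_signed maximal_signed_imp_exposed weak_star_exposed_imp_extreme
      weak_star_strongly_exposed_imp_exposed by blast
qed

end
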